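(* Let $R\in\mathbb{SO}(3)$. Then $$\left\Vert \mathbf{vex}\left(\boldsymbol{\mathcal{P}}_{a}(R)\right)\right\Vert^{2}=4\left(1-\left\Vert R\right\Vert_{I}\right)\left\Vert R\right\Vert_{I}.$$
   Context: $\mathbb{SO}(3)=\{R\in\mathbb{R}^{3\times3}: R^{\top}R=RR^{\top}=\mathbf{I}_{3},\ \det(R)=+1\}$; $\Vert\cdot\Vert$ is the Euclidean norm on vectors. For $x=[x_1,x_2,x_3]^{\top}\in\mathbb{R}^{3}$, $[x]_{\times}=\begin{bmatrix} 0 & -x_3 & x_2 \\ x_3 & 0 & -x_1 \\ -x_2 & x_1 & 0 \end{bmatrix}$. The map $\mathbf{vex}$ from $3\times3$ skew-symmetric matrices to $\mathbb{R}^{3}$ is the inverse of $[\cdot]_{\times}$, i.e. $\mathbf{vex}([x]_{\times})=x$. For $B\in\mathbb{R}^{3\times3}$, $\boldsymbol{\mathcal{P}}_{a}(B)=\frac{1}{2}(B-B^{\top})$. For $R\in\mathbb{SO}(3)$ the normalized Euclidean distance is $\Vert R\Vert_{I}=\frac{1}{4}\mathrm{Tr}\{\mathbf{I}_{3}-R\}$. *)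

theory Defs
  imports "HOL-Analysis.Analysis"
begin

definition SO3 :: "(real^3^3) set" where
  "SO3 = {R. rotation_matrix R}"

lemma SO3_iff:
  "R \<in> SO3 \<longleftrightarrow> transpose R ** R = mat 1 \<and> R ** transpose R = mat 1 \<and> det R = 1"
  by (simp add: SO3_def rotation_matrix_def orthogonal_matrix_def)

definition cross_mat :: "real^3 \<Rightarrow> real^3^3" where
  "cross_mat x = vector [vector [0, - x$3, x$2],
                         vector [x$3, 0, - x$1],
                         vector [- x$2, x$1, 0]]"

(* The inverse of cross_mat on its range, the skew-symmetric matrices
   (see vex_cross_mat and cross_mat_vex); vex A is unspecified for other A. *)
definition vex :: "real^3^3 \<Rightarrow> real^3" where
  "vex = inv cross_mat"

lemma inj_cross_mat: "inj cross_mat"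
proof (rule injI)
  fix x y assume "cross_mat x = cross_mat y"
  then have "cross_mat x $ i $ j = cross_mat y $ i $ j" for i j
    by simp
  from this[of 3 2] this[of 1 3] this[of 2 1] show "x = y"
    by (simp add: cross_mat_def vec_eq_iff forall_3)
qed

lemma vex_cross_mat: "vex (cross_mat x) = x"
  by (simp add: vex_def inj_cross_mat)

lemma range_cross_mat: "range cross_mat = {A. transpose A = - A}"
proof (intro set_eqI iffI)
  fix A assume "A \<in> range cross_mat"
  then show "A \<in> {A. transpose A = - A}"
    by (auto simp: cross_mat_def transpose_def vec_eq_iff forall_3)
next
  fix A :: "real^3^3" assume "A \<in> {A. transpose A = - A}"
  then have "transpose A $ i $ j = (- A) $ i $ j" for i j
    by simp
  then have skew: "A $ j $ i = - A $ i $ j" for i j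
    unfolding transpose_def vector_uminus_component vec_lambda_beta .
  have diag: "A $ i $ i = 0" for i
    using skew[of i i] by linarith
  have "A = cross_mat (vector [A$3$2, A$1$3, A$2$1])"
    using diag skew[of 1 2] skew[of 1 3] skew[of 2 3]
    by (simp add: cross_mat_def vec_eq_iff forall_3)
  then show "A \<in> range cross_mat"
    by blast
qed

lemma cross_mat_vex: "transpose A = - A \<Longrightarrow> cross_mat (vex A) = A"
  using range_cross_mat by (simp add: vex_def f_inv_into_f)

definition anti_proj :: "real^3^3 \<Rightarrow> real^3^3" where
  "anti_proj B = (1/2) *\<^sub>R (B - transpose B)"

(* The normalized Euclidean distance of a rotation from the identity. *)
definition dist_I :: "real^3^3 \<Rightarrow> real" where
  "dist_I R = 1/4 * trace (mat 1 - R)"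

end

theory Submission
  imports Defs
begin

text \<open>Since the rows of R have unit length, the claim reduces to the trace of R being
  the sum of its principal 2x2 minors. This holds because a rotation respects the
  cross product, that is, equals its own cofactor matrix.\<close>

text \<open>\<open>vex\<close> is defined only as an inverse function, so its values come from
  \<open>cross_mat_vex\<close>. The entries chosen are those where \<open>cross_mat\<close> carries
  its coordinates with positive sign.\<close>

lemma vex_skew:
  assumes "transpose A = - A"
  shows "vex A = vector [A$3$2, A$1$3, A$2$1]"
proof -
  have "cross_mat (vex A) $ i $ j = A $ i $ j" for i j
    by (simp add: cross_mat_vex assms)
  from this[of 3 2] this[of 1 3] this[of 2 1] show ?thesis
    by (simp add: cross_mat_def vec_eq_iff forall_3)
qed

lemma norm_vex_anti_proj:
  "(norm (vex (anti_proj B)))\<^sup>2 =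
    ((B$3$2 - B$2$3)\<^sup>2 + (B$1$3 - B$3$1)\<^sup>2 + (B$2$1 - B$1$2)\<^sup>2) / 4"
proof -
  have "transpose (anti_proj B) = - anti_proj B"
    by (simp add: anti_proj_def transpose_def vec_eq_iff field_simps)
  then show ?thesis
    unfolding power2_norm_eq_inner vex_skew
    by (simp add: vex_skew inner_vec_def sum_3 anti_proj_def transpose_def
        power2_eq_square field_simps)
qed

lemma rotation_matrix_diag_eq_minor:
  fixes R :: "real^3^3"
  assumes "rotation_matrix R"
  shows "R$1$1 = R$2$2 * R$3$3 - R$2$3 * R$3$2"
    and "R$2$2 = R$1$1 * R$3$3 - R$1$3 * R$3$1"
    and "R$3$3 = R$1$1 * R$2$2 - R$1$2 * R$2$1"
proof -
  have "cross3 (R *v axis i 1) (R *v axis j 1) $ k = (R *v cross3 (axis i 1) (axis j 1)) $ k" for i j k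
    using assms by (simp add: cross_rotation_matrix)
  \<comment> \<open>For these cyclic triples, \<open>axis i 1\<close> and \<open>axis j 1\<close>
    have cross product \<open>axis k 1\<close>. The right side is thus \<open>R$k$k\<close>, and the
    left side is the minor on rows and columns \<open>i\<close>, \<open>j\<close>.\<close>
  from this[of 2 3 1] this[of 3 1 2] this[of 1 2 3]
  show "R$1$1 = R$2$2 * R$3$3 - R$2$3 * R$3$2"
    and "R$2$2 = R$1$1 * R$3$3 - R$1$3 * R$3$1"
    and "R$3$3 = R$1$1 * R$2$2 - R$1$2 * R$2$1"
    by (simp_all add: cross3_def matrix_vector_mult_def sum_3 axis_def algebra_simps)
qed

lemma orthogonal_matrix_row_norm:
  fixes R :: "real^3^3"
  assumes "orthogonal_matrix R"
  shows "(R$i$1)\<^sup>2 + (R$i$2)\<^sup>2 + (R$i$3)\<^sup>2 = 1"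
proof -
  have "(R ** transpose R) $ i $ i = 1"
    using assms by (simp add: orthogonal_matrix_def mat_def)
  then show ?thesis
    by (simp add: matrix_matrix_mult_def transpose_def sum_3 power2_eq_square)
qed

theorem lemma3:
  fixes R :: "real^3^3"
  assumes "R \<in> SO3"
  shows "(norm (vex (anti_proj R)))\<^sup>2 = 4 * (1 - dist_I R) * dist_I R"
proof -
  have rot: "rotation_matrix R" and orth: "orthogonal_matrix R"
    using assms by (simp_all add: SO3_def rotation_matrix_def)
  define t where "t = R$1$1 + R$2$2 + R$3$3"
  have minors: "t = R$2$2 * R$3$3 - R$2$3 * R$3$2 + (R$1$1 * R$3$3 - R$1$3 * R$3$1)
      + (R$1$1 * R$2$2 - R$1$2 * R$2$1)"
    using rotation_matrix_diag_eq_minor[OF rot] unfolding t_def by linarith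
  \<comment> \<open>A polynomial identity valid for every 3x3 matrix: subtracting
    \<open>t\<^sup>2\<close> removes the squares and the pairwise products of the diagonal
    entries.\<close>
  have "(R$3$2 - R$2$3)\<^sup>2 + (R$1$3 - R$3$1)\<^sup>2 + (R$2$1 - R$1$2)\<^sup>2 =
      (\<Sum>i\<in>UNIV. (R$i$1)\<^sup>2 + (R$i$2)\<^sup>2 + (R$i$3)\<^sup>2)
      + 2 * (R$2$2 * R$3$3 - R$2$3 * R$3$2 + (R$1$1 * R$3$3 - R$1$3 * R$3$1)
        + (R$1$1 * R$2$2 - R$1$2 * R$2$1)) - t\<^sup>2"
    by (simp add: t_def sum_3 power2_eq_square algebra_simps)
  \<comment> \<open>The three unit rows contribute 3, and the minors add up to
    \<open>t\<close>.\<close>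
  also have "\<dots> = 3 + 2 * t - t\<^sup>2"
    by (simp add: orthogonal_matrix_row_norm[OF orth] minors[symmetric])
  finally have "(norm (vex (anti_proj R)))\<^sup>2 = (3 + 2 * t - t\<^sup>2) / 4"
    by (simp only: norm_vex_anti_proj)
  moreover have "dist_I R = (3 - t) / 4"
    by (simp add: dist_I_def trace_def sum_3 mat_def t_def)
  \<comment> \<open>Both sides equal \<open>(3 - t) * (1 + t) / 4\<close>, since
    \<open>1 - dist_I R\<close> is \<open>(1 + t) / 4\<close>.\<close>
  ultimately show ?thesis
    by (simp only:) (simp add: power2_eq_square field_simps)
qed

end
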